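(* Let $d\geq 3$ and $n\geq 2$ be integers and let $x^{(1)},\dots,x^{(n)}$ be drawn independently and uniformly at random from the closed $d$-dimensional unit ball $\overline{\mathrm{B}}_1(0)\subseteq\mathbb{R}^d$. Then $$\mathrm{P}\Bigl[\bigl|\langle x^{(j)},x^{(k)}\rangle\bigr|\leq \frac{\sqrt{6\ln n}}{\sqrt{d-1}}\ \text{ for all } j\neq k\Bigr]\geq 1-\frac{1}{n}.$$
   Context: $\langle\cdot,\cdot\rangle$ is the Euclidean scalar product and $\overline{\mathrm{B}}_1(0)=\{x\in\mathbb{R}^d : \|x\|\leq 1\}$ with the Euclidean norm. A random vector $X$ is uniformly distributed on $\overline{\mathrm{B}}_1(0)$ if $\mathrm{P}[X\in A]=\lambda^d(A\cap \overline{\mathrm{B}}_1(0))/\lambda^d(\overline{\mathrm{B}}_1(0))$ for every Borel set $A\subseteq\mathbb{R}^d$, where $\lambda^d$ is $d$-dimensional Lebesgue measure. *)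

theory Defs
  imports "HOL-Probability.Probability"
begin

end

theory Submission
  imports Defs
begin

text \<open>
  The heart of the matter is that a cap of the unit ball fits into a much smaller ball. If
  \<open>norm v \<le> 1\<close>, \<open>norm x \<le> 1\<close> and \<open>t < v \<bullet> x\<close>, then expanding the square gives
  \<open>(dist (t *\<^sub>R v) x)\<^sup>2 \<le> 1 - t\<^sup>2\<close>. Comparing volumes in dimension \<open>d\<close>, a uniform
  random point \<open>x\<close> of the unit ball lies in the cap with probability at most
  \<open>(1 - t\<^sup>2) powr (d / 2) \<le> exp (- d * t\<^sup>2 / 2)\<close> if \<open>0 \<le> t \<le> 1\<close>, and the cap is empty
  if \<open>t > 1\<close> (lemma \<open>uniform_cball_cap_le\<close>). The bound is the same for every \<open>v\<close> in the closed
  unit ball, so by Fubini's theorem it also holds when \<open>v\<close> is an independent random vector of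
  norm at most 1 (lemma \<open>prob_inner_gt_le\<close>).

  With \<open>t\<^sup>2 = 6 * ln n / (d - 1)\<close> the bound is at most \<open>n powr - 3\<close>. For the union
  bound, the two signs are spread over the two orderings of a pair: if \<open>j < k\<close>, then
  \<open>x j \<bullet> x k\<close> exceeds \<open>t\<close> in absolute value iff one of the one-sided events \<open>t < x j \<bullet> x k\<close> and
  \<open>t < - (x k \<bullet> x j)\<close> occurs. So there is one event for each ordered pair, hence at most
  \<open>n\<^sup>2\<close> of them, and the failure probability is at most \<open>n\<^sup>2 * n powr - 3 = 1 / n\<close>.
\<close>

text \<open>
  Since \<open>sqrt\<close> is negative at negative arguments, for \<open>t > 1\<close> the ball on the right is empty and
  the inclusion says that there is no cap.
\<close>
lemma cap_subset_cball:
  fixes v :: "'a::euclidean_space"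
  assumes "norm v \<le> 1" and "t \<ge> 0"
  shows "cball 0 1 \<inter> {x. t < v \<bullet> x} \<subseteq> cball (t *\<^sub>R v) (sqrt (1 - t\<^sup>2))"
proof
  fix x assume "x \<in> cball 0 1 \<inter> {x. t < v \<bullet> x}"
  then have x: "norm x \<le> 1" "t < v \<bullet> x" by auto
  have "(dist (t *\<^sub>R v) x)\<^sup>2 = t\<^sup>2 * (norm v)\<^sup>2 - 2 * (t * (v \<bullet> x)) + (norm x)\<^sup>2"
    unfolding dist_norm power2_norm_eq_inner
    by (simp add: inner_diff_left inner_diff_right inner_commute power2_eq_square algebra_simps)
  moreover have "t\<^sup>2 * (norm v)\<^sup>2 \<le> t\<^sup>2 * 1"
    using assms by (intro mult_left_mono) (auto simp: power_le_one)
  moreover have "(norm x)\<^sup>2 \<le> 1"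
    using x by (simp add: power_le_one)
  moreover have "t * t \<le> t * (v \<bullet> x)"
    using x assms by (intro mult_left_mono) auto
  ultimately have "(dist (t *\<^sub>R v) x)\<^sup>2 \<le> 1 - t\<^sup>2"
    by (simp add: power2_eq_square)
  then show "x \<in> cball (t *\<^sub>R v) (sqrt (1 - t\<^sup>2))"
    using real_le_rsqrt by auto
qed

text \<open>
  The volume of the enclosing ball relative to the unit ball is the \<open>d\<close>-th power of its
  radius, and \<open>sqrt (1 - t\<^sup>2) \<le> exp (- t\<^sup>2 / 2)\<close> because \<open>1 - t\<^sup>2 \<le> exp (- t\<^sup>2)\<close>.
\<close>
lemma uniform_cball_cap_le:
  fixes v :: "'a::euclidean_space"
  assumes v: "norm v \<le> 1" and t: "t \<ge> 0"
  shows "emeasure (uniform_measure lborel (cball 0 1)) {x. t < v \<bullet> x}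
           \<le> ennreal (exp (- (real DIM('a) * t\<^sup>2 / 2)))"
proof (cases "t\<^sup>2 \<le> 1")
  case True
  define r where "r = sqrt (1 - t\<^sup>2)"
  have r: "r \<ge> 0" using True by (simp add: r_def)
  have "1 - t\<^sup>2 \<le> (exp (- (t\<^sup>2 / 2)))\<^sup>2"
    using exp_ge_add_one_self[of "- t\<^sup>2"] by (simp flip: exp_double)
  then have "r \<le> exp (- (t\<^sup>2 / 2))"
    unfolding r_def by (intro real_le_lsqrt) auto
  then have "r ^ DIM('a) \<le> exp (- (t\<^sup>2 / 2)) ^ DIM('a)"
    using r by (intro power_mono)
  also have "\<dots> = exp (- (real DIM('a) * t\<^sup>2 / 2))"
    by (simp flip: exp_of_nat_mult)
  finally have rd: "r ^ DIM('a) \<le> exp (- (real DIM('a) * t\<^sup>2 / 2))" .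
  have cap: "{x. t < v \<bullet> x} \<in> sets borel" by measurable
  have "emeasure (uniform_measure lborel (cball 0 1)) {x. t < v \<bullet> x}
      = emeasure lborel (cball 0 1 \<inter> {x. t < v \<bullet> x}) / emeasure lborel (cball (0::'a) 1)"
    using cap by simp
  also have "\<dots> \<le> emeasure lborel (cball (t *\<^sub>R v) r) / emeasure lborel (cball (0::'a) 1)"
    using cap_subset_cball[OF v t]
    by (intro divide_right_mono_ennreal emeasure_mono) (auto simp: r_def)
  also have "\<dots> = ennreal (r ^ DIM('a))"
    using r unit_ball_vol_pos[of "real DIM('a)"]
    by (simp add: emeasure_cball divide_ennreal less_imp_neq[symmetric])
  also have "\<dots> \<le> ennreal (exp (- (real DIM('a) * t\<^sup>2 / 2)))"
    using rd by (rule ennreal_leI)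
  finally show ?thesis .
next
  case False
  then have "cball 0 1 \<inter> {x. t < v \<bullet> x} = {}"
    using cap_subset_cball[OF v t] by auto
  moreover have "{x. t < v \<bullet> x} \<in> sets borel" by measurable
  ultimately show ?thesis by simp
qed

text \<open>
  The cap bound is uniform in the direction \<open>v\<close>, so it survives integration over the
  distribution of \<open>Y\<close>.
\<close>
lemma (in prob_space) prob_inner_gt_le:
  fixes X Y :: "'a \<Rightarrow> 'b::euclidean_space"
  assumes indep: "indep_var borel Y borel X"
    and X: "distr M borel X = uniform_measure lborel (cball 0 1)"
    and Y: "AE \<omega> in M. norm (Y \<omega>) \<le> 1"
    and t: "t \<ge> 0"
  shows "prob {\<omega>\<in>space M. t < Y \<omega> \<bullet> X \<omega>} \<le> exp (- (real DIM('b) * t\<^sup>2 / 2))"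
proof -
  have [measurable]: "Y \<in> borel_measurable M" "X \<in> borel_measurable M"
    using indep indep_var_rv1 indep_var_rv2 by blast+
  interpret Y: prob_space "distr M borel Y" by (rule prob_space_distr) simp
  interpret X: prob_space "distr M borel X" by (rule prob_space_distr) simp
  let ?A = "{p :: 'b \<times> 'b. t < fst p \<bullet> snd p}"
  have A: "?A \<in> sets (borel \<Otimes>\<^sub>M borel)"
    unfolding borel_prod by (intro borel_open open_Collect_less continuous_intros)
  have "emeasure M {\<omega>\<in>space M. t < Y \<omega> \<bullet> X \<omega>}
      = emeasure (distr M (borel \<Otimes>\<^sub>M borel) (\<lambda>\<omega>. (Y \<omega>, X \<omega>))) ?A"
    using A by (subst emeasure_distr) (auto intro!: arg_cong[where f = "emeasure M"])
  also have "\<dots> = emeasure (distr M borel Y \<Otimes>\<^sub>M distr M borel X) ?A"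
    using indep by (simp add: indep_var_distribution_eq)
  also have "\<dots> = (\<integral>\<^sup>+y. emeasure (distr M borel X) {x. t < y \<bullet> x} \<partial>distr M borel Y)"
    using A by (subst X.emeasure_pair_measure_alt) (auto simp: vimage_def intro!: nn_integral_cong)
  also have "\<dots> \<le> (\<integral>\<^sup>+y. ennreal (exp (- (real DIM('b) * t\<^sup>2 / 2))) \<partial>distr M borel Y)"
  proof (rule nn_integral_mono_AE)
    have "AE y in distr M borel Y. norm y \<le> 1"
      using Y by (subst AE_distr_iff) auto
    then show "AE y in distr M borel Y. emeasure (distr M borel X) {x. t < y \<bullet> x}
        \<le> ennreal (exp (- (real DIM('b) * t\<^sup>2 / 2)))"
      by eventually_elim (simp only: X uniform_cball_cap_le t)
  qed
  also have "\<dots> = ennreal (exp (- (real DIM('b) * t\<^sup>2 / 2)))"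
    using Y.emeasure_space_1 by simp
  finally show ?thesis
    by (simp add: emeasure_eq_measure)
qed

lemma (in prob_space) indep_vars_imp_indep_var:
  assumes "indep_vars N X I" and "i \<in> I" "j \<in> I" "i \<noteq> j"
  shows "indep_var (N i) (X i) (N j) (X j)"
proof -
  have "indep_var (N i) ((\<lambda>f. f i) \<circ> (\<lambda>\<omega>. restrict (\<lambda>k. X k \<omega>) {i}))
                  (N j) ((\<lambda>f. f j) \<circ> (\<lambda>\<omega>. restrict (\<lambda>k. X k \<omega>) {j}))"
    using assms by (intro indep_var_compose[OF indep_var_restrict[OF assms(1)]]) auto
  then show ?thesis
    by (simp add: comp_def)
qed

theorem theorem2p8:
  fixes M :: "'w measure"
    and x :: "nat \<Rightarrow> 'w \<Rightarrow> real ^ 'd"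
    and n :: nat
  assumes "prob_space M"
    and "CARD('d) \<ge> 3"
    and "n \<ge> 2"
    and "prob_space.indep_vars M (\<lambda>_. borel) x {1..n}"
    and "\<And>j. j \<in> {1..n} \<Longrightarrow> distr M borel (x j) = uniform_measure lborel (cball 0 1)"
  shows "measure M {\<omega> \<in> space M. \<forall>j\<in>{1..n}. \<forall>k\<in>{1..n}. j \<noteq> k \<longrightarrow>
            \<bar>x j \<omega> \<bullet> x k \<omega>\<bar> \<le> sqrt (6 * ln (real n)) / sqrt (real CARD('d) - 1)}
          \<ge> 1 - 1 / real n"
proof -
  interpret prob_space M by fact
  define t where "t = sqrt (6 * ln (real n)) / sqrt (real CARD('d) - 1)"
  have t0: "t \<ge> 0" using assms(2,3) by (simp add: t_def)
  have t2: "t\<^sup>2 = 6 * ln (real n) / (real CARD('d) - 1)"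
    using assms(2,3) by (simp add: t_def power_divide)
  have rv[measurable]: "x j \<in> borel_measurable M" if "j \<in> {1..n}" for j
    using assms(4) that by (auto simp: indep_vars_def)
  have norm_x: "AE \<omega> in M. norm (x j \<omega>) \<le> 1" if j: "j \<in> {1..n}" for j
  proof -
    have "AE y in distr M borel (x j). norm y \<le> 1"
      unfolding assms(5)[OF j] by (rule AE_uniform_measureI) auto
    then show ?thesis
      using rv[OF j] by (subst (asm) AE_distr_iff) auto
  qed

  have cube: "exp (- (real DIM(real ^ 'd) * t\<^sup>2 / 2)) \<le> 1 / real n ^ 3"
  proof -
    \<comment> \<open>\<open>t\<close> is tuned to dimension \<open>d - 1\<close>, where the exponent is exactly \<open>3 * ln n\<close>\<close>
    have "3 * ln (real n) = (real CARD('d) - 1) * t\<^sup>2 / 2"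
      using assms(2) by (simp add: t2)
    also have "\<dots> \<le> real CARD('d) * t\<^sup>2 / 2"
      by (intro divide_right_mono mult_right_mono) auto
    finally have "exp (- (real DIM(real ^ 'd) * t\<^sup>2 / 2)) \<le> exp (- (3 * ln (real n)))"
      by simp
    also have "\<dots> = 1 / exp (ln (real n)) ^ 3"
      by (simp add: exp_minus field_simps flip: exp_of_nat_mult)
    finally show ?thesis using assms(3) by simp
  qed

  define P where "P = {(j, k) \<in> {1..n} \<times> {1..n}. j \<noteq> k}"
  \<comment> \<open>opposite signs on \<open>(j, k)\<close> and \<open>(k, j)\<close>, so that the two one-sided events make up the two-sided one\<close>
  define \<sigma> :: "nat \<times> nat \<Rightarrow> real" where "\<sigma> = (\<lambda>(j, k). if j < k then 1 else - 1)"
  define bad where "bad = (\<lambda>(j, k). {\<omega>\<in>space M. t < (\<sigma> (j, k) *\<^sub>R x j \<omega>) \<bullet> x k \<omega>})"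
  have finP: "finite P" and cardP: "card P \<le> n\<^sup>2"
  proof -
    have sub: "P \<subseteq> {1..n} \<times> {1..n}" by (auto simp: P_def)
    then show "finite P" by (rule finite_subset) auto
    show "card P \<le> n\<^sup>2"
      using card_mono[OF _ sub] by (simp add: power2_eq_square)
  qed
  have bad_sets: "bad p \<in> events" if "p \<in> P" for p
  proof -
    obtain j k where p: "p = (j, k)" and "j \<in> {1..n}" "k \<in> {1..n}"
      using \<open>p \<in> P\<close> by (auto simp: P_def)
    then have [measurable]: "x j \<in> borel_measurable M" "x k \<in> borel_measurable M"
      using rv by auto
    show ?thesis unfolding bad_def p prod.case by measurable
  qed
  have bad_prob: "prob (bad p) \<le> 1 / real n ^ 3" if "p \<in> P" for p
  proof -
    obtain j k where p: "p = (j, k)" and jk: "j \<in> {1..n}" "k \<in> {1..n}" "j \<noteq> k"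
      using \<open>p \<in> P\<close> by (auto simp: P_def)
    have "indep_var borel ((\<lambda>y. \<sigma> p *\<^sub>R y) \<circ> x j) borel ((\<lambda>y. y) \<circ> x k)"
      by (rule indep_var_compose[OF indep_vars_imp_indep_var[OF assms(4) jk]]) auto
    then have indep: "indep_var borel (\<lambda>\<omega>. \<sigma> p *\<^sub>R x j \<omega>) borel (x k)"
      by (simp add: comp_def)
    have "AE \<omega> in M. norm (\<sigma> p *\<^sub>R x j \<omega>) \<le> 1"
      using norm_x[OF jk(1)] by (simp add: \<sigma>_def p)
    from prob_inner_gt_le[OF indep assms(5)[OF jk(2)] this t0] cube
    show ?thesis by (simp add: bad_def p)
  qed

  let ?good = "{\<omega>\<in>space M. \<forall>j\<in>{1..n}. \<forall>k\<in>{1..n}. j \<noteq> k \<longrightarrow> \<bar>x j \<omega> \<bullet> x k \<omega>\<bar> \<le> t}"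
  have good_bad: "?good = space M - (\<Union>p\<in>P. bad p)"
  proof (intro set_eqI iffI)
    fix \<omega> assume "\<omega> \<in> ?good"
    then have *: "\<bar>x j \<omega> \<bullet> x k \<omega>\<bar> \<le> t" if "(j, k) \<in> P" for j k
      using that by (auto simp: P_def)
    have "\<omega> \<notin> bad (j, k)" if "(j, k) \<in> P" for j k
      using *[OF that] by (simp add: bad_def \<sigma>_def abs_le_iff)
    with \<open>\<omega> \<in> ?good\<close> show "\<omega> \<in> space M - (\<Union>p\<in>P. bad p)"
      by auto
  next
    fix \<omega> assume \<omega>: "\<omega> \<in> space M - (\<Union>p\<in>P. bad p)"
    have *: "\<sigma> (j, k) * (x j \<omega> \<bullet> x k \<omega>) \<le> t"
      if "j \<in> {1..n}" "k \<in> {1..n}" "j \<noteq> k" for j k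
    proof -
      have "(j, k) \<in> P" using that by (simp add: P_def)
      with \<omega> have "\<omega> \<in> space M" "\<omega> \<notin> bad (j, k)" by blast+
      then show ?thesis by (simp add: bad_def)
    qed
    have "\<bar>x j \<omega> \<bullet> x k \<omega>\<bar> \<le> t" if jk: "j \<in> {1..n}" "k \<in> {1..n}" "j \<noteq> k" for j k
      using *[OF jk] *[OF jk(2,1) jk(3)[symmetric]] jk(3)
      by (cases "j < k") (auto simp: \<sigma>_def inner_commute)
    then show "\<omega> \<in> ?good" using \<omega> by blast
  qed
  have "prob (\<Union>p\<in>P. bad p) \<le> (\<Sum>p\<in>P. prob (bad p))"
    using finP bad_sets by (intro finite_measure_subadditive_finite) auto
  also have "\<dots> \<le> real (card P) * (1 / real n ^ 3)"
    using bad_prob by (rule sum_bounded_above)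
  also have "\<dots> \<le> real (n\<^sup>2) * (1 / real n ^ 3)"
    using cardP
    by (intro mult_right_mono)
       (simp_all only: of_nat_le_iff zero_le_divide_1_iff zero_le_power of_nat_0_le_iff)
  also have "\<dots> = 1 / real n"
    using assms(3) by (simp add: power2_eq_square power3_eq_cube)
  finally have "prob (\<Union>p\<in>P. bad p) \<le> 1 / real n" .
  moreover have "prob ?good = 1 - prob (\<Union>p\<in>P. bad p)"
    unfolding good_bad using finP bad_sets by (intro prob_compl) auto
  ultimately show ?thesis
    by (simp only: t_def)
qed

end
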